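(* Let $G$ be a finite simple undirected graph that is connected. Let $n$ be the number of vertices of $G$, $p$ the order of a longest path in $G$, and $c$ the order of a longest cycle in $G$. If $$\frac{1}{2}\sigma_2\ge \frac{p}{2},$$ then $c=p=n$.
   Context: All graphs are finite, undirected, without loops or multiple edges. The order of a path or cycle is its number of vertices. By convention a single vertex and a single edge are regarded as cycles of orders 1 and 2, respectively (so $c\ge 1$ always, and for instance $c=1$ for $K_1$ and $c=2$ for $K_2$). Let $\alpha$ be the independence number of $G$. If $\alpha\ge 2$, $\sigma_2$ denotes the minimum of $d(x)+d(y)$ over all pairs of distinct nonadjacent vertices $x,y$ of $G$; if $\alpha<2$, then $\sigma_2=+\infty$ (so the hypothesis on $\sigma_2$ holds automatically). *)

theory Defs
  imports "Graph_Theory.Graph_Theory" "HOL-Library.Extended_Real"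
begin

text \<open>
  A finite simple undirected graph is a digraph satisfying the locale \<^term>\<open>graph\<close>
  of the AFP entry Graph Theory: finite, symmetric, without loops and without parallel
  arcs. Each undirected edge is thus a pair of opposite arcs, so the out-degree of a
  vertex is its degree, and the adjacency of \<open>x\<close> and \<open>y\<close> is
  \<open>x \<rightarrow>\<^bsub>G\<^esub> y\<close>, that is, \<open>(x, y) \<in> arcs_ends G\<close>.
\<close>

abbreviation degree :: "('a, 'b) pre_digraph \<Rightarrow> 'a \<Rightarrow> nat" where
  "degree G v \<equiv> out_degree G v"

definition independent_set :: "('a, 'b) pre_digraph \<Rightarrow> 'a set \<Rightarrow> bool" where
  "independent_set G S \<longleftrightarrow>
     S \<subseteq> verts G \<and> (\<forall>x\<in>S. \<forall>y\<in>S. x \<noteq> y \<longrightarrow> \<not> x \<rightarrow>\<^bsub>G\<^esub> y)"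

definition independence_number :: "('a, 'b) pre_digraph \<Rightarrow> nat" where
  "independence_number G = Max {card S | S. independent_set G S}"

definition nonadjacent_degree_sums :: "('a, 'b) pre_digraph \<Rightarrow> nat set" where
  "nonadjacent_degree_sums G =
     {degree G x + degree G y | x y.
        x \<in> verts G \<and> y \<in> verts G \<and> x \<noteq> y \<and> \<not> x \<rightarrow>\<^bsub>G\<^esub> y}"

definition sigma2 :: "('a, 'b) pre_digraph \<Rightarrow> ereal" where
  "sigma2 G =
     (if independence_number G \<ge> 2
      then ereal (real (Min (nonadjacent_degree_sums G))) else \<infinity>)"

definition path_orders :: "('a, 'b) pre_digraph \<Rightarrow> nat set" where
  "path_orders G = {length vs | vs. vpath vs G}"

definition longest_path_order :: "('a, 'b) pre_digraph \<Rightarrow> nat" where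
  "longest_path_order G = Max (path_orders G)"

text \<open>
  A cycle of the library is a nonempty closed arc walk that repeats no vertex except
  for its end; its vertices are the tails of its arcs. As graphs are symmetric digraphs,
  an edge \<open>ab\<close> already gives the cycle \<open>a, b, a\<close> with two vertices, which
  realises the convention that a single edge is a cycle of order 2. The convention that
  a single vertex is a cycle of order 1 is added explicitly.
\<close>

definition cycle_orders :: "('a, 'b) pre_digraph \<Rightarrow> nat set" where
  "cycle_orders G =
     {card (tail G ` set C) | C. pre_digraph.cycle G C} \<union> {card {v} | v. v \<in> verts G}"

definition longest_cycle_order :: "('a, 'b) pre_digraph \<Rightarrow> nat" where
  "longest_cycle_order G = Max (cycle_orders G)"

text \<open>The maxima and minima above range over finite nonempty sets.\<close>

lemma (in fin_digraph) independent_set_cards: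
  shows "finite {card S | S. independent_set G S}" "{card S | S. independent_set G S} \<noteq> {}"
proof -
  have "{card S | S. independent_set G S} \<subseteq> card ` Pow (verts G)"
    by (auto simp: independent_set_def)
  then show "finite {card S | S. independent_set G S}"
    by (rule finite_subset) simp
  have "independent_set G {}"
    by (simp add: independent_set_def)
  then show "{card S | S. independent_set G S} \<noteq> {}"
    by blast
qed

lemma (in fin_digraph) nonadjacent_degree_sums:
  shows "finite (nonadjacent_degree_sums G)"
    and "independence_number G \<ge> 2 \<Longrightarrow> nonadjacent_degree_sums G \<noteq> {}"
proof -
  have "nonadjacent_degree_sums G \<subseteq> (\<lambda>(x, y). degree G x + degree G y) ` (verts G \<times> verts G)"
    by (auto simp: nonadjacent_degree_sums_def)
  then show "finite (nonadjacent_degree_sums G)"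
    by (rule finite_subset) simp
  assume *: "independence_number G \<ge> 2"
  obtain S where S: "independent_set G S" "card S \<ge> 2"
    using Max_in[OF independent_set_cards] * unfolding independence_number_def by auto
  then have "finite S" "\<not> card S \<le> Suc 0"
    by (auto intro: card_ge_0_finite)
  then obtain x y where "x \<in> S" "y \<in> S" "x \<noteq> y"
    using card_le_Suc0_iff_eq by blast
  then show "nonadjacent_degree_sums G \<noteq> {}"
    using S(1) unfolding nonadjacent_degree_sums_def independent_set_def by blast
qed

lemma (in fin_digraph) path_orders:
  shows "finite (path_orders G)" and "verts G \<noteq> {} \<Longrightarrow> path_orders G \<noteq> {}"
proof -
  have "path_orders G \<subseteq> length ` {vs. vpath vs G}"
    by (auto simp: path_orders_def)
  moreover have "finite {vs. vpath vs G}"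
    by (rule vpaths_finite)
  ultimately show "finite (path_orders G)"
    by (meson finite_imageI finite_subset)
  assume "verts G \<noteq> {}"
  then obtain v where "v \<in> verts G" by blast
  then have "vpath [v] G" by (simp add: vpath_def vwalk_def)
  then show "path_orders G \<noteq> {}" by (auto simp: path_orders_def)
qed

lemma (in fin_digraph) cycle_orders:
  shows "finite (cycle_orders G)" and "verts G \<noteq> {} \<Longrightarrow> cycle_orders G \<noteq> {}"
proof -
  have "card {v} \<in> card ` Pow (verts G)" if "v \<in> verts G" for v
    using that by (intro imageI) auto
  moreover have "card (tail G ` set C) \<in> card ` Pow (verts G)" if "cycle C" for C
    using that by (intro imageI) (auto simp: cycle_def awalk_def)
  ultimately have "cycle_orders G \<subseteq> card ` Pow (verts G)"
    unfolding cycle_orders_def by blast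
  then show "finite (cycle_orders G)"
    by (rule finite_subset) simp
  show "verts G \<noteq> {} \<Longrightarrow> cycle_orders G \<noteq> {}"
    by (auto simp: cycle_orders_def)
qed

text \<open>Out-degrees count neighbours, and single edges have cycle order 2.\<close>

lemma (in nomulti_digraph) degree_eq_card_neighbours:
  "degree G v = card {w. v \<rightarrow> w}"
proof -
  have "{w. v \<rightarrow> w} = head G ` out_arcs G v"
    by (auto simp: out_arcs_def arcs_ends_conv)
  moreover have "inj_on (head G) (out_arcs G v)"
    by (rule inj_onI) (auto simp: out_arcs_def arc_to_ends_def intro!: no_multi_arcs)
  ultimately show ?thesis
    by (simp add: out_degree_def card_image)
qed

lemma (in graph) edge_cycle_order:
  assumes "x \<rightarrow> y"
  shows "2 \<in> cycle_orders G"
proof -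
  obtain e where e: "e \<in> arcs G" "tail G e = x" "head G e = y"
    using assms by (auto simp: arcs_ends_conv)
  have "y \<rightarrow> x"
    using assms by (rule graph_symmetric)
  then obtain f where f: "f \<in> arcs G" "tail G f = y" "head G f = x"
    by (auto simp: arcs_ends_conv)
  have "x \<noteq> y"
    using e no_loops[of e] by auto
  then have "cycle [e, f]"
    using e f by (auto simp: cycle_def awalk_def cas_simp)
  moreover have "card (tail G ` set [e, f]) = 2"
    using e f \<open>x \<noteq> y\<close> by simp
  ultimately show ?thesis
    unfolding cycle_orders_def by (intro UnI1 CollectI exI[of _ "[e, f]"]) simp
qed

end

theory Submission
  imports Defs
begin

text \<open>
  This is Ore's argument applied to a longest path. The neighbours of both ends lie on the
  path, so by counting, the path either closes up directly or some two consecutive vertices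
  allow it to be closed after reversing the part behind them. Either way its vertices
  form a cycle. In a connected graph, a vertex outside this cycle would have a neighbour
  on it (for a suitable choice) and would extend the opened cycle to a longer path.
\<close>

text \<open>Path orders are measured on vertex lists, cycles on arc lists. Choosing an arc for every
  consecutive pair of vertices passes from the first to the second.\<close>

lemma (in wf_digraph) awalk_of_vwalk:
  assumes "vwalk vs G"
  shows "\<exists>es. awalk (hd vs) es (last vs) \<and> awalk_verts (hd vs) es = vs"
  using assms
proof (induct rule: vwalk_induct)
  case (Base u)
  show ?case
    using Base by (intro exI[of _ "[]"]) (simp add: awalk_def)
next
  case (Cons u v vs)
  obtain es where es: "awalk v es (last (v # vs))" "awalk_verts v es = v # vs"
    using Cons(2) by auto
  obtain e where "e \<in> arcs G" "tail G e = u" "head G e = v"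
    using Cons(1) by (auto simp: arcs_ends_conv)
  moreover have "u \<in> verts G"
    using Cons(1) by (rule adj_in_verts)
  ultimately show ?case
    using es by (intro exI[of _ "e # es"]) (simp add: awalk_def)
qed

lemma (in wf_digraph) closed_vpath_cycle_order:
  assumes vs: "vpath vs G" and closed: "last vs \<rightarrow> hd vs"
  shows "length vs \<in> cycle_orders G"
proof -
  obtain es where es: "awalk (hd vs) es (last vs)" "awalk_verts (hd vs) es = vs"
    using awalk_of_vwalk vs by (metis vpathE)
  obtain e where e: "e \<in> arcs G" "tail G e = last vs" "head G e = hd vs"
    using closed by (auto simp: arcs_ends_conv)
  have "vs \<noteq> []" "distinct vs"
    using vs by auto
  \<comment> \<open>Based at \<open>last vs\<close>, this closed walk visits
    \<open>last vs # vs\<close>, so distinctness after the base point is just distinctness of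
    \<open>vs\<close>.\<close>
  have "cycle (e # es)"
    unfolding cycle_def
    using e es \<open>distinct vs\<close> by (intro exI[of _ "last vs"]) (auto simp: awalk_Cons_iff)
  moreover have "tail G ` set (e # es) = set vs"
  proof -
    \<comment> \<open>The tails of \<open>es\<close> miss only the final vertex, which is the tail
      of the closing arc \<open>e\<close>.\<close>
    have "vs = map (tail G) es @ [last vs]"
      using es \<open>vs \<noteq> []\<close>
      by (cases "es = []") (auto simp: awalk_verts_conv last_map)
    then have "set vs = set (map (tail G) es @ [last vs])"
      by simp
    then show ?thesis
      using e by auto
  qed
  ultimately have "card (set vs) \<in> cycle_orders G"
    unfolding cycle_orders_def by (metis (mono_tags, lifting) UnI1 mem_Collect_eq)
  then show ?thesis
    using \<open>distinct vs\<close> by (simp add: distinct_card)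
qed

lemma (in sym_digraph) vpath_rev:
  assumes "vpath vs G"
  shows "vpath (rev vs) G"
proof -
  have "set (vwalk_arcs (rev vs)) \<subseteq> arcs_ends G"
    using assms graph_symmetric unfolding set_vwalk_arcs_rev vpath_def vwalk_def by blast
  then show ?thesis
    using assms by (simp add: vpath_def vwalk_def)
qed

lemma vpath_append:
  assumes "vpath xs G" "vpath ys G" "last xs \<rightarrow>\<^bsub>G\<^esub> hd ys" "set xs \<inter> set ys = {}"
  shows "vpath (xs @ ys) G"
  using assms by (auto simp: vpath_def vwalk_def vwalk_arcs_append)

lemma vpath_appendD:
  assumes "vpath (xs @ ys) G"
  shows "xs \<noteq> [] \<Longrightarrow> vpath xs G" "ys \<noteq> [] \<Longrightarrow> vpath ys G"
  using assms vwalkI_append_l[of xs ys G] vwalkI_append_r[of ys xs G] by (simp_all add: vpath_def)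

lemma (in wf_digraph) vpath_Cons:
  assumes "vpath vs G" "u \<rightarrow> hd vs" "u \<notin> set vs"
  shows "vpath (u # vs) G"
  using assms by (auto simp: vpath_def intro: vwalk_wf_digraph_consI)

lemma (in fin_digraph) vpath_length_le:
  assumes "vpath vs G"
  shows "length vs \<le> longest_path_order G"
  using assms Max_ge[OF path_orders(1)]
  unfolding longest_path_order_def by (auto simp: path_orders_def)

text \<open>Otherwise \<open>u\<close> could be put in front, giving a path longer than the
  maximum.\<close>

lemma (in fin_digraph) longest_vpath_hd_neighbours:
  assumes "vpath vs G" "length vs = longest_path_order G" "u \<rightarrow> hd vs"
  shows "u \<in> set vs"
  using vpath_length_le[OF vpath_Cons[OF assms(1,3)]] assms(2) by (cases "u \<in> set vs") auto

text \<open>Pigeonhole: the positions of the neighbours of \<open>hd vs\<close>, shifted down by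
  one, and those of the neighbours of \<open>last vs\<close> all lie among the first
  \<open>length vs - 1\<close> indices, but together they number at least
  \<open>length vs\<close>.\<close>

lemma (in graph) ore_crossing:
  assumes vs: "vpath vs G"
    and nbrs: "\<And>w. hd vs \<rightarrow> w \<Longrightarrow> w \<in> set vs" "\<And>w. last vs \<rightarrow> w \<Longrightarrow> w \<in> set vs"
    and deg: "length vs \<le> degree G (hd vs) + degree G (last vs)"
  shows "\<exists>i. Suc i < length vs \<and> hd vs \<rightarrow> vs ! Suc i \<and> last vs \<rightarrow> vs ! i"
proof -
  let ?m = "length vs - 1"
  define A where "A = {i. i < ?m \<and> hd vs \<rightarrow> vs ! Suc i}"
  define B where "B = {i. i < ?m \<and> last vs \<rightarrow> vs ! i}"
  have "vs \<noteq> []"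
    using vs by auto
  have fin: "finite A" "finite B"
    by (auto simp: A_def B_def)
  have "{w. hd vs \<rightarrow> w} \<subseteq> (\<lambda>i. vs ! Suc i) ` A"
  proof
    fix w assume "w \<in> {w. hd vs \<rightarrow> w}"
    then have w: "hd vs \<rightarrow> w" by simp
    then obtain j where j: "j < length vs" "vs ! j = w"
      using nbrs(1) by (auto simp: in_set_conv_nth)
    \<comment> \<open>Without loops \<open>hd vs\<close> is not its own neighbour, so the shift to
      \<open>j - 1\<close> is legitimate.\<close>
    have "j \<noteq> 0"
      using w j \<open>vs \<noteq> []\<close> adj_not_same by (metis hd_conv_nth)
    then show "w \<in> (\<lambda>i. vs ! Suc i) ` A"
      using w j by (intro image_eqI[of _ _ "j - 1"]) (auto simp: A_def)
  qed
  then have "degree G (hd vs) \<le> card A"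
    unfolding degree_eq_card_neighbours using fin by (blast intro: surj_card_le)
  moreover have "{w. last vs \<rightarrow> w} \<subseteq> (!) vs ` B"
  proof
    fix w assume "w \<in> {w. last vs \<rightarrow> w}"
    then have w: "last vs \<rightarrow> w" by simp
    then obtain j where j: "j < length vs" "vs ! j = w"
      using nbrs(2) by (auto simp: in_set_conv_nth)
    have "j \<noteq> ?m"
      using w j \<open>vs \<noteq> []\<close> adj_not_same by (metis last_conv_nth)
    then show "w \<in> (!) vs ` B"
      using w j by (intro image_eqI[of _ _ j]) (auto simp: B_def)
  qed
  then have "degree G (last vs) \<le> card B"
    unfolding degree_eq_card_neighbours using fin by (blast intro: surj_card_le)
  moreover have "card (A \<union> B) \<le> card {..<?m}"
    by (intro card_mono) (auto simp: A_def B_def)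
  \<comment> \<open>Disjoint \<open>A\<close> and \<open>B\<close> would have at most
    \<open>length vs - 1\<close> elements together. As \<open>vs\<close> is nonempty, this
    subtraction is not truncated.\<close>
  ultimately have "A \<inter> B \<noteq> {}"
    using deg \<open>vs \<noteq> []\<close> card_Un_disjoint[OF fin] by (cases vs) auto
  then show ?thesis
    by (auto simp: A_def B_def)
qed

text \<open>Cut between positions \<open>i\<close> and \<open>Suc i\<close> and reverse the second
  piece: the edge from \<open>last vs\<close> to \<open>vs ! i\<close> rejoins the pieces, and the
  edge from \<open>hd vs\<close> to \<open>vs ! Suc i\<close> joins the new ends.\<close>

lemma (in graph) crossing_closed_vpath:
  assumes vs: "vpath vs G" and i: "Suc i < length vs"
    and adj: "hd vs \<rightarrow> vs ! Suc i" "last vs \<rightarrow> vs ! i"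
  shows "\<exists>cs. vpath cs G \<and> set cs = set vs \<and> last cs \<rightarrow> hd cs"
proof -
  let ?xs = "take (Suc i) vs" and ?ys = "drop (Suc i) vs"
  have ne: "?xs \<noteq> []" "?ys \<noteq> []"
    using i by auto
  have split: "vpath (?xs @ ?ys) G"
    using vs by simp
  have "last ?xs = vs ! i"
    using i by (simp add: take_Suc_conv_app_nth)
  moreover have "hd ?xs = hd vs"
    by (cases vs) auto
  ultimately have ends: "last ?xs = vs ! i" "hd ?ys = vs ! Suc i" "last ?ys = last vs" "hd ?xs = hd vs"
    using i by (simp_all add: hd_drop_conv_nth)
  have "vpath (?xs @ rev ?ys) G"
  proof (rule vpath_append)
    show "vpath ?xs G" "vpath (rev ?ys) G"
      using vpath_appendD[OF split] ne by (auto intro: vpath_rev)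
    show "last ?xs \<rightarrow> hd (rev ?ys)"
      using adj(2) ne ends by (simp only: hd_rev) (rule graph_symmetric)
    show "set ?xs \<inter> set (rev ?ys) = {}"
      using vs by (simp add: vpath_def set_take_disj_set_drop_if_distinct)
  qed
  moreover have "set (?xs @ rev ?ys) = set vs"
    by (metis append_take_drop_id set_append set_rev)
  moreover have "last (?xs @ rev ?ys) \<rightarrow> hd (?xs @ rev ?ys)"
  proof -
    have "last (?xs @ rev ?ys) = vs ! Suc i" "hd (?xs @ rev ?ys) = hd vs"
      using ne ends by (simp_all only: last_appendR rev_is_Nil_conv last_rev hd_append2 simp_thms)
    then show ?thesis
      using adj(1) graph_symmetric by simp
  qed
  ultimately show ?thesis
    by blast
qed

text \<open>By symmetry connectedness is strong connectedness, and a set closed under adjacency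
  contains all that is reachable from any of its members.\<close>

lemma (in sym_digraph) connected_vertex_set_all:
  assumes conn: "connected G" and S: "S \<subseteq> verts G" "S \<noteq> {}"
    and closed: "\<And>v w. v \<in> S \<Longrightarrow> v \<rightarrow> w \<Longrightarrow> w \<in> S"
  shows "S = verts G"
proof -
  obtain s where s: "s \<in> S"
    using S by blast
  have "w \<in> S" if "w \<in> verts G" for w
  proof -
    have "s \<rightarrow>\<^sup>* w"
      using symmetric_connected_imp_strongly_connected[OF sym_arcs conn] s S that by auto
    then show ?thesis
      by (induct rule: reachable_induct) (use s closed in auto)
  qed
  then show ?thesis
    using S by blast
qed

text \<open>The closing arc allows rotating the path so that it starts at \<open>w\<close>; then
  \<open>u\<close> goes in front.\<close>

lemma (in wf_digraph) closed_vpath_extend: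
  assumes cs: "vpath cs G" "last cs \<rightarrow> hd cs"
    and w: "w \<in> set cs" "u \<rightarrow> w" "u \<notin> set cs"
  shows "\<exists>vs. vpath vs G \<and> length vs = Suc (length cs)"
proof -
  obtain xs ys where split: "cs = xs @ w # ys"
    using w(1) by (meson split_list)
  have "vpath ((w # ys) @ xs) G"
  proof (cases "xs = []")
    case True
    then show ?thesis using cs split by simp
  next
    case False
    show ?thesis
      using vpath_appendD[of xs "w # ys" G] cs False
      by (intro vpath_append) (auto simp: split vpath_def)
  qed
  then have "vpath (u # (w # ys) @ xs) G"
    using w(2,3) by (intro vpath_Cons) (auto simp: split)
  then show ?thesis
    by (intro exI[of _ "u # (w # ys) @ xs"]) (simp add: split)
qed

lemma (in fin_digraph) sigma2_le:
  assumes "x \<in> verts G" "y \<in> verts G" "x \<noteq> y" "\<not> x \<rightarrow> y" "\<not> y \<rightarrow> x"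
  shows "sigma2 G \<le> ereal (real (degree G x + degree G y))"
proof -
  have "independent_set G {x, y}"
    using assms by (auto simp: independent_set_def)
  then have "card {x, y} \<le> independence_number G"
    unfolding independence_number_def by (intro Max_ge[OF independent_set_cards(1)]) blast
  then have "2 \<le> independence_number G"
    using assms by simp
  moreover have "Min (nonadjacent_degree_sums G) \<le> degree G x + degree G y"
    using assms by (intro Min_le[OF nonadjacent_degree_sums(1)]) (auto simp: nonadjacent_degree_sums_def)
  ultimately show ?thesis
    by (simp add: sigma2_def)
qed

lemma (in fin_digraph) cycle_order_le_card_verts:
  assumes "k \<in> cycle_orders G"
  shows "k \<le> card (verts G)"
proof -
  have "tail G ` set C \<subseteq> verts G" if "cycle C" for C
    using that by (auto simp: cycle_def awalk_def)
  moreover have "{v} \<subseteq> verts G" if "v \<in> verts G" for v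
    using that by simp
  ultimately show ?thesis
    using assms card_mono[OF finite_verts] by (fastforce simp only: cycle_orders_def)
qed

lemma (in graph) longest_vpath_closes:
  assumes vs: "vpath vs G" "length vs = longest_path_order G" "2 \<le> length vs"
    and sigma: "ereal (real (length vs)) \<le> sigma2 G"
  shows "\<exists>cs. vpath cs G \<and> set cs = set vs \<and> last cs \<rightarrow> hd cs"
proof (cases "last vs \<rightarrow> hd vs")
  case True
  then show ?thesis using vs by blast
next
  case False
  have ne: "vs \<noteq> []" "distinct vs" "set vs \<subseteq> verts G"
    using vs(1) by auto
  then have "hd vs \<noteq> last vs"
    using vs(3) by (cases vs) (auto split: if_splits)
  then have "sigma2 G \<le> ereal (real (degree G (hd vs) + degree G (last vs)))"
    using ne False graph_symmetric by (intro sigma2_le) auto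
  with sigma have "ereal (real (length vs)) \<le> ereal (real (degree G (hd vs) + degree G (last vs)))"
    by (rule order_trans)
  then have deg: "length vs \<le> degree G (hd vs) + degree G (last vs)"
    by (simp only: ereal_less_eq of_nat_le_iff)
  have "w \<in> set vs" if "hd vs \<rightarrow> w" for w
    using longest_vpath_hd_neighbours[OF vs(1,2)] graph_symmetric[OF that] by simp
  \<comment> \<open>The reversed path is also longest and starts at \<open>last vs\<close>.\<close>
  moreover have "w \<in> set vs" if "last vs \<rightarrow> w" for w
    using longest_vpath_hd_neighbours[OF vpath_rev[OF vs(1)]] vs(2) graph_symmetric[OF that]
    by (simp add: hd_rev)
  ultimately show ?thesis
    using ore_crossing[OF vs(1) _ _ deg] crossing_closed_vpath[OF vs(1)] by blast
qed

theorem theorem1: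
  fixes G :: "('a, 'b) pre_digraph" and n p c :: nat
  assumes "graph G"
    and "Digraph_Component.connected G"
    and "n = card (verts G)"
    and "p = longest_path_order G"
    and "c = longest_cycle_order G"
    and "ereal (1 / 2) * sigma2 G \<ge> ereal (real p / 2)"
  shows "c = p \<and> p = n"
proof -
  interpret graph G by fact
  note conn = assms(2)
  have ne: "verts G \<noteq> {}"
    using conn by (simp add: connected_conv)
  obtain vs where vs: "vpath vs G" "length vs = p"
    using Max_in[OF path_orders(1) path_orders(2)[OF ne]] assms(4)
    by (auto simp: longest_path_order_def path_orders_def)
  then have vs': "vs \<noteq> []" "distinct vs" "set vs \<subseteq> verts G"
    by auto
  have sigma: "ereal (real p) \<le> sigma2 G"
    using assms(6) by (cases "sigma2 G") auto
  have "p \<in> cycle_orders G \<and> set vs = verts G"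
  proof (cases "2 \<le> p")
    case True
    then obtain cs where cs: "vpath cs G" "set cs = set vs" "last cs \<rightarrow>\<^bsub>G\<^esub> hd cs"
      using longest_vpath_closes vs sigma assms(4) by metis
    then have len: "length cs = p"
      using vs by (metis distinct_card vpathE)
    \<comment> \<open>A neighbour outside \<open>cs\<close> would yield a path of order
      \<open>p + 1\<close>.\<close>
    have "set cs = verts G"
    proof (rule connected_vertex_set_all[OF conn])
      show "set cs \<subseteq> verts G" "set cs \<noteq> {}"
        using cs vs' by auto
      show "w \<in> set cs" if "v \<in> set cs" "v \<rightarrow>\<^bsub>G\<^esub> w" for v w
        using closed_vpath_extend[OF cs(1,3) that(1) graph_symmetric[OF that(2)]]
          vpath_length_le len assms(4) by fastforce
    qed
    then show ?thesis
      using closed_vpath_cycle_order[OF cs(1,3)] len cs(2) by simp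
  next
    \<comment> \<open>The longest path is a single vertex, so its cycle is the one of order 1
      granted by convention.\<close>
    case False
    then obtain v where v: "vs = [v]"
      using vs vs' by (cases vs) (auto simp: not_le)
    have "set vs = verts G"
    proof (rule connected_vertex_set_all[OF conn])
      show "w \<in> set vs" if "u \<in> set vs" "u \<rightarrow>\<^bsub>G\<^esub> w" for u w
        using longest_vpath_hd_neighbours[OF vs(1)] vs(2) assms(4) that graph_symmetric v by auto
    qed (use vs' in auto)
    moreover have "card {v} \<in> cycle_orders G"
      unfolding cycle_orders_def using vs' v by auto
    moreover have "card {v} = p"
      using v vs by simp
    ultimately show ?thesis
      by simp
  qed
  moreover from this have "p = n"
    using assms(3) vs vs' by (metis distinct_card)
  \<comment> \<open>Every cycle order is at most \<open>n\<close>, which equals \<open>p\<close>,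
    and \<open>p\<close> itself is attained.\<close>
  moreover have "c = p"
    unfolding assms(5) longest_cycle_order_def
    using calculation assms(3) cycle_order_le_card_verts
    by (intro Max_eqI[OF cycle_orders(1)]) auto
  ultimately show ?thesis
    by simp
qed

end
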